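(* Let $a,b,c,d$ be real numbers with $0<a<1$, $0<c<1$, $b>0$ and $d>0$. Then there exist a positive integer $N$ and a pair $(X,Y)$ of random variables with values in $\{0,1,\dots,N\}$ such that $$\mathbb{E}[X\mid Y]=cY+d,\qquad \mathbb{E}[Y\mid X]=aX+b.$$
   Context: The conditional expectation identities are understood almost surely, i.e. with $p_{ij}=\mathbb{P}(X=i,Y=j)$ one has $\sum_{j=0}^N(ai+b-j)p_{ij}=0$ for all $i\in\{0,\dots,N\}$ and $\sum_{i=0}^N(cj+d-i)p_{ij}=0$ for all $j\in\{0,\dots,N\}$. *)

theory Defs
  imports "HOL-Probability.Probability"
begin

end

theory Submission
  imports Defs
begin

text \<open>
  For a weight \<open>p\<close> on the grid, call \<open>\<Sum>y. p x y * (a * x + b - y)\<close> the imbalance of row \<open>x\<close> and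
  \<open>\<Sum>x. p x y * (c * y + d - x)\<close> the imbalance of column \<open>y\<close>; all of them have to vanish.
  The unit mass at the origin has imbalance \<open>b\<close> in row \<open>0\<close> and \<open>d\<close> in column \<open>0\<close>, and no other.
  Choosing \<open>j > b\<close> and then \<open>i\<close> large, one can balance row \<open>i\<close> and all columns with positive
  weights at \<open>(i, j)\<close>, \<open>(i, i)\<close>, \<open>(0, j)\<close>, \<open>(0, i)\<close>, which leaves only a negative imbalance in
  row \<open>0\<close>. Adding suitable multiples of this weight and of the transposed construction to the
  unit mass, and normalising, gives the joint law.
\<close>

text \<open>Turns the analytic condition into finitely many sums. The events generated by
  \<open>Y\<close> are unions of fibres of \<open>Y\<close>, and set integrals for a point measure
  are finite sums, so the defining identity of conditional expectation only has to be checked on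
  single fibres, which is \<open>balance\<close>.\<close>

lemma real_cond_exp_point_measure:
  fixes f g :: "'a \<Rightarrow> real" and h :: "'b \<Rightarrow> real"
  assumes fin: "finite \<Omega>" and f: "\<And>w. w \<in> \<Omega> \<Longrightarrow> 0 \<le> f w" and Y: "Y \<in> \<Omega> \<rightarrow> S"
    and balance: "\<And>s. s \<in> S \<Longrightarrow> (\<Sum>w\<in>{w\<in>\<Omega>. Y w = s}. f w * (h s - g w)) = 0"
  defines "M \<equiv> point_measure \<Omega> f"
  shows "AE w in M. real_cond_exp M (vimage_algebra (space M) Y (count_space S)) g w = h (Y w)"
proof -
  let ?F = "vimage_algebra (space M) Y (count_space S)"
  have space: "space M = \<Omega>" and sets: "sets M = Pow \<Omega>"
    unfolding M_def by (rule space_point_measure sets_point_measure)+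
  have setsF: "sets ?F = {Y -` A \<inter> \<Omega> | A. A \<in> Pow S}"
    using Y by (simp add: space sets_vimage_algebra2)
  have "finite_measure M"
    by (rule finite_measureI) (simp add: M_def space_point_measure emeasure_point_measure_finite fin)
  then have "finite_measure_subalgebra M ?F"
    unfolding finite_measure_subalgebra_def finite_measure_subalgebra_axioms_def subalgebra_def
    by (auto simp: setsF sets)
  then interpret finite_measure_subalgebra M ?F .
  show ?thesis
  proof (rule real_cond_exp_charact)
    fix A assume "A \<in> sets ?F"
    then obtain B where B: "B \<subseteq> S" "A = Y -` B \<inter> \<Omega>" by (auto simp: setsF)
    have A: "finite A" "A \<subseteq> \<Omega>" using fin B by auto
    have int: "(\<integral>w\<in>A. k w \<partial>M) = (\<Sum>w\<in>A. f w * k w)" for k :: "'a \<Rightarrow> real"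
    proof -
      have "(\<integral>w\<in>A. k w \<partial>M) = (\<Sum>w\<in>\<Omega>. f w *\<^sub>R (indicator A w *\<^sub>R k w))"
        unfolding M_def set_lebesgue_integral_def
        by (rule lebesgue_integral_point_measure_finite[OF fin f])
      also have "\<dots> = (\<Sum>w\<in>A. f w * k w)"
        using A fin by (intro sum.mono_neutral_cong_right) (auto simp: indicator_def)
      finally show ?thesis .
    qed
    have "(\<Sum>w\<in>A. f w * h (Y w)) - (\<Sum>w\<in>A. f w * g w) = (\<Sum>w\<in>A. f w * (h (Y w) - g w))"
      by (simp add: sum_subtractf right_diff_distrib)
    also have "\<dots> = (\<Sum>s\<in>Y ` A. \<Sum>w\<in>{w\<in>A. Y w = s}. f w * (h (Y w) - g w))"
      by (rule sum.image_gen[OF A(1)])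
    \<comment> \<open>As a preimage, \<open>A\<close> contains every fibre it meets, so restricting
      to \<open>A\<close> does not cut the fibres.\<close>
    also have "\<dots> = (\<Sum>s\<in>Y ` A. \<Sum>w\<in>{w\<in>\<Omega>. Y w = s}. f w * (h s - g w))"
      using B by (intro sum.cong) auto
    also have "\<dots> = 0"
      using B by (intro sum.neutral ballI balance) auto
    finally show "(\<integral>w\<in>A. g w \<partial>M) = (\<integral>w\<in>A. h (Y w) \<partial>M)"
      by (simp add: int)
  next
    show "integrable M g" "integrable M (\<lambda>w. h (Y w))"
      unfolding M_def by (rule integrable_point_measure_finite[OF fin])+
    have "Y \<in> measurable ?F (count_space S)"
      using Y by (intro measurable_vimage_algebra1) (simp add: space)
    then show "(\<lambda>w. h (Y w)) \<in> borel_measurable ?F"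
      by (rule measurable_compose) simp
  qed
qed

lemma sum_two_points:
  fixes f :: "nat \<Rightarrow> 'a::comm_monoid_add"
  assumes "m \<le> N" "n \<le> N" "m \<noteq> n" "\<And>k. k \<noteq> m \<Longrightarrow> k \<noteq> n \<Longrightarrow> f k = 0"
  shows "(\<Sum>k\<le>N. f k) = f m + f n"
proof -
  have "(\<Sum>k\<le>N. f k) = (\<Sum>k\<in>{m, n}. f k)"
    using assms by (intro sum.mono_neutral_right) auto
  then show ?thesis using assms by simp
qed

text \<open>It works because of signs. Row \<open>i\<close> has a positive term at \<open>j\<close>
  and a negative one at \<open>i\<close>, so positive weights can cancel there; so do columns
  \<open>j\<close> and \<open>i\<close>, with a positive term at row \<open>0\<close> and a negative
  one at row \<open>i\<close>. In row \<open>0\<close> both terms are negative, since b < j < i.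
  Allowing every large \<open>N\<close> lets two such weights share one grid.\<close>

lemma weight_unbalanced_in_row_zero:
  fixes a b c d :: real
  assumes a: "0 < a" "a < 1" and c: "0 < c" "c < 1" and b: "0 < b" and d: "0 < d"
  obtains q :: "nat \<Rightarrow> nat \<Rightarrow> real" and n :: nat where
    "\<And>x y. 0 \<le> q x y"
    "\<And>N x. n \<le> N \<Longrightarrow> (\<Sum>y\<le>N. q x y * (a * real x + b - real y)) = - of_bool (x = 0)"
    "\<And>N y. n \<le> N \<Longrightarrow> (\<Sum>x\<le>N. q x y * (c * real y + d - real x)) = 0"
proof -
  obtain j :: nat where j: "b < real j" using reals_Archimedean2 by blast
  \<comment> \<open>The four lower bounds yield, in order, \<open>ia\<close>, \<open>ib\<close>,
    \<open>ic\<close> and \<open>id\<close>; the second and the fourth rely on a < 1 and c <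
    1.\<close>
  obtain i :: nat where i: "max (max (j / a) (b / (1 - a))) (max (c * j + d) (d / (1 - c))) < real i"
    using reals_Archimedean2 by blast
  have ia: "real j < a * i + b"
  proof -
    have "j / a < i" using i by simp
    then show ?thesis using a b by (simp add: field_simps)
  qed
  have ib: "a * i + b < i"
  proof -
    have "b / (1 - a) < i" using i by simp
    then show ?thesis using a by (simp add: field_simps)
  qed
  have ic: "c * j + d < i" using i by simp
  have id: "c * i + d < i"
  proof -
    have "d / (1 - c) < i" using i by simp
    then show ?thesis using c by (simp add: field_simps)
  qed
  have ji: "j < i" using ia ib by simp
  have j0: "0 < j" using j b by (cases j) auto
  have cp: "0 < c * real k + d" for k :: nat using c d by (simp add: add_nonneg_pos)
  \<comment> \<open>The weights \<alpha> at (i, j) and \<beta> at (i, i) balance row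
    \<open>i\<close>, where the imbalance is \<alpha>\<beta> - \<beta>\<alpha>. Then \<gamma> at (0,
    j) and \<delta> at (0, i) are the solutions of the equations for columns \<open>j\<close> and
    \<open>i\<close>.\<close>
  define \<alpha> where "\<alpha> = i - (a * i + b)"
  define \<beta> where "\<beta> = a * i + b - j"
  define \<gamma> where "\<gamma> = (i - (c * j + d)) * \<alpha> / (c * j + d)"
  define \<delta> where "\<delta> = (i - (c * i + d)) * \<beta> / (c * i + d)"
  have pos: "0 < \<alpha>" "0 < \<beta>" using ia ib by (auto simp: \<alpha>_def \<beta>_def)
  have pos': "0 < \<gamma>" "0 < \<delta>" using pos ic id cp by (auto simp: \<gamma>_def \<delta>_def)
  \<comment> \<open>The imbalance of row \<open>0\<close> before scaling is -K; dividing all weights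
    by \<open>K\<close> makes it -1.\<close>
  define K where "K = \<gamma> * (j - b) + \<delta> * (i - b)"
  have K: "0 < K" using pos' j ji by (auto simp: K_def intro!: add_pos_pos)
  define q where "q x y =
    (if y = j then (if x = i then \<alpha> / K else if x = 0 then \<gamma> / K else 0)
     else if y = i then (if x = i then \<beta> / K else if x = 0 then \<delta> / K else 0) else 0)" for x y :: nat
  show thesis
  proof (rule that)
    show "0 \<le> q x y" for x y
      using pos pos' K by (simp add: q_def)
  next
    fix N x assume N: "i \<le> N"
    have "(\<Sum>y\<le>N. q x y * (a * real x + b - real y)) =
        q x j * (a * real x + b - real j) + q x i * (a * real x + b - real i)"
      using N ji by (intro sum_two_points) (auto simp: q_def)
    also have "\<dots> = - of_bool (x = 0)"
    proof -
      consider "x = i" | "x = 0" | "x \<noteq> i" "x \<noteq> 0" by blast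
      then show ?thesis
      proof cases
        case 1
        have "(\<alpha> * (a * i + b - j) + \<beta> * (a * i + b - i)) / K = 0"
          by (simp add: \<alpha>_def \<beta>_def algebra_simps)
        then show ?thesis using 1 ji by (simp add: q_def add_divide_distrib)
      next
        case 2
        have "\<gamma> / K * (b - j) + \<delta> / K * (b - i) = - (K / K)"
        proof -
          have "\<gamma> * (b - j) + \<delta> * (b - i) = - K"
            by (simp add: K_def algebra_simps)
          then have "(\<gamma> * (b - j) + \<delta> * (b - i)) / K = - K / K"
            by simp
          then show ?thesis
            by (simp add: add_divide_distrib)
        qed
        then show ?thesis using 2 ji K by (simp add: q_def)
      qed (simp add: q_def)
    qed
    finally show "(\<Sum>y\<le>N. q x y * (a * real x + b - real y)) = - of_bool (x = 0)" .
  next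
    fix N y assume N: "i \<le> N"
    have "(\<Sum>x\<le>N. q x y * (c * real y + d - real x)) =
        q 0 y * (c * real y + d - real 0) + q i y * (c * real y + d - real i)"
      using N ji by (intro sum_two_points) (auto simp: q_def)
    also have "\<dots> = 0"
    proof -
      consider "y = j" | "y = i" | "y \<noteq> j" "y \<noteq> i" by blast
      then show ?thesis
      proof cases
        case 1
        have "\<gamma> * (c * j + d) = (i - (c * j + d)) * \<alpha>"
          using cp[of j] by (simp add: \<gamma>_def)
        then have "(\<gamma> * (c * j + d) + \<alpha> * (c * j + d - i)) / K = 0"
          by (simp add: algebra_simps)
        then show ?thesis using 1 ji by (simp add: q_def add_divide_distrib)
      next
        case 2
        have "\<delta> * (c * i + d) = (i - (c * i + d)) * \<beta>"
          using cp[of i] by (simp add: \<delta>_def)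
        then have "(\<delta> * (c * i + d) + \<beta> * (c * i + d - i)) / K = 0"
          by (simp add: algebra_simps)
        then show ?thesis using 2 ji by (simp add: q_def add_divide_distrib)
      qed (simp add: q_def)
    qed
    finally show "(\<Sum>x\<le>N. q x y * (c * real y + d - real x)) = 0" .
  qed
qed

lemma balanced_probability_weight:
  fixes a b c d :: real
  assumes a: "0 < a" "a < 1" and c: "0 < c" "c < 1" and b: "0 < b" and d: "0 < d"
  obtains p :: "nat \<Rightarrow> nat \<Rightarrow> real" and N :: nat where
    "0 < N" "\<And>x y. 0 \<le> p x y" "(\<Sum>x\<le>N. \<Sum>y\<le>N. p x y) = 1"
    "\<And>x. (\<Sum>y\<le>N. p x y * (a * real x + b - real y)) = 0"
    "\<And>y. (\<Sum>x\<le>N. p x y * (c * real y + d - real x)) = 0"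
proof -
  obtain q n where q: "\<And>x y. 0 \<le> q x y"
    "\<And>N x. n \<le> N \<Longrightarrow> (\<Sum>y\<le>N. q x y * (a * real x + b - real y)) = - of_bool (x = 0)"
    "\<And>N y. n \<le> N \<Longrightarrow> (\<Sum>x\<le>N. q x y * (c * real y + d - real x)) = 0"
    using weight_unbalanced_in_row_zero[OF a c b d] by blast
  \<comment> \<open>The same lemma with (a, b) and (c, d) exchanged: \<open>r\<close> is to be read
    on the transposed grid, hence \<open>r y x\<close> below.\<close>
  obtain r m where r: "\<And>x y. 0 \<le> r x y"
    "\<And>N x. m \<le> N \<Longrightarrow> (\<Sum>y\<le>N. r x y * (c * real x + d - real y)) = - of_bool (x = 0)"
    "\<And>N y. m \<le> N \<Longrightarrow> (\<Sum>x\<le>N. r x y * (a * real y + b - real x)) = 0"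
    using weight_unbalanced_in_row_zero[OF c a d b] by blast
  \<comment> \<open>\<open>Suc\<close> guarantees that \<open>N\<close> is positive.\<close>
  define N where "N = Suc (max n m)"
  have N: "n \<le> N" "m \<le> N" "0 < N" by (auto simp: N_def)
  \<comment> \<open>The term with \<open>b\<close> cancels the imbalance \<open>b\<close> of row
    \<open>0\<close> and leaves the columns alone; the term with \<open>d\<close> cancels the
    imbalance \<open>d\<close> of column \<open>0\<close> and leaves the rows alone.\<close>
  define p where "p x y = of_bool (x = 0 \<and> y = 0) + b * q x y + d * r y x" for x y :: nat
  have p: "0 \<le> p x y" for x y using q(1) r(1) b d by (simp add: p_def)
  have row: "(\<Sum>y\<le>N. p x y * (a * real x + b - real y)) = 0" for x
  proof -
    have "(\<Sum>y\<le>N. p x y * (a * real x + b - real y)) =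
        (\<Sum>y\<le>N. if y = 0 then of_bool (x = 0) * (a * real x + b) else 0)
        + b * (\<Sum>y\<le>N. q x y * (a * real x + b - real y))
        + d * (\<Sum>y\<le>N. r y x * (a * real x + b - real y))"
      unfolding sum_distrib_left sum.distrib[symmetric]
      by (intro sum.cong refl) (simp add: p_def distrib_right mult.assoc of_bool_conj)
    then show ?thesis using N by (simp only: q r) (cases "x = 0"; simp)
  qed
  have col: "(\<Sum>x\<le>N. p x y * (c * real y + d - real x)) = 0" for y
  proof -
    have "(\<Sum>x\<le>N. p x y * (c * real y + d - real x)) =
        (\<Sum>x\<le>N. if x = 0 then of_bool (y = 0) * (c * real y + d) else 0)
        + b * (\<Sum>x\<le>N. q x y * (c * real y + d - real x))
        + d * (\<Sum>x\<le>N. r y x * (c * real y + d - real x))"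
      unfolding sum_distrib_left sum.distrib[symmetric]
      by (intro sum.cong refl) (simp add: p_def distrib_right mult.assoc of_bool_conj)
    then show ?thesis using N by (simp only: q r) (cases "y = 0"; simp)
  qed
  define T where "T = (\<Sum>x\<le>N. \<Sum>y\<le>N. p x y)"
  \<comment> \<open>The mass at the origin keeps the total \<open>T\<close> positive, so dividing by
    \<open>T\<close> is possible; the balance equations are homogeneous and survive it.\<close>
  have "0 < p 0 0" using q(1)[of 0 0] r(1)[of 0 0] b d by (simp add: p_def add_pos_nonneg)
  then have T: "0 < T"
    unfolding T_def using p
    by (intro sum_pos2[of _ 0] sum_nonneg) (auto intro!: sum_pos2[of _ 0])
  show thesis
  proof (rule that)
    show "0 < N" by (rule N)
    show "0 \<le> p x y / T" for x y using p T by simp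
    show "(\<Sum>x\<le>N. \<Sum>y\<le>N. p x y / T) = 1"
      using T by (simp add: T_def flip: sum_divide_distrib)
    show "(\<Sum>y\<le>N. p x y / T * (a * real x + b - real y)) = 0" for x
      using row[of x] by (simp flip: sum_divide_distrib)
    show "(\<Sum>x\<le>N. p x y / T * (c * real y + d - real x)) = 0" for y
      using col[of y] by (simp flip: sum_divide_distrib)
  qed
qed

theorem theorem7:
  fixes a b c d :: real
  assumes "0 < a" and "a < 1" and "0 < c" and "c < 1" and "0 < b" and "0 < d"
  shows "\<exists>(N::nat) (M :: (nat \<times> nat) measure) (X :: nat \<times> nat \<Rightarrow> nat) (Y :: nat \<times> nat \<Rightarrow> nat).
           0 < N \<and> prob_space M \<and>
           X \<in> measurable M (count_space {0..N}) \<and>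
           Y \<in> measurable M (count_space {0..N}) \<and>
           (AE w in M. real_cond_exp M (vimage_algebra (space M) Y (count_space {0..N}))
                         (\<lambda>w. real (X w)) w = c * real (Y w) + d) \<and>
           (AE w in M. real_cond_exp M (vimage_algebra (space M) X (count_space {0..N}))
                         (\<lambda>w. real (Y w)) w = a * real (X w) + b)"
proof -
  obtain p N where N: "0 < N" and p: "\<And>x y. 0 \<le> p x y" "(\<Sum>x\<le>N. \<Sum>y\<le>N. p x y) = 1"
    and row: "\<And>x. (\<Sum>y\<le>N. p x y * (a * real x + b - real y)) = 0"
    and col: "\<And>y. (\<Sum>x\<le>N. p x y * (c * real y + d - real x)) = 0"
    by (rule balanced_probability_weight[OF assms], rule that)
  \<comment> \<open>The random variables are the coordinates \<open>fst\<close> and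
    \<open>snd\<close> on the grid. Their fibres are its rows and columns, so the fibre sums below
    become \<open>row\<close> and \<open>col\<close>.\<close>
  define \<Omega> where "\<Omega> = {..N} \<times> {..N}"
  define f where "f = (\<lambda>(x, y). p x y)"
  define M where "M = point_measure \<Omega> f"
  have fin: "finite \<Omega>" by (simp add: \<Omega>_def)
  have f: "0 \<le> f w" for w using p(1) by (simp add: f_def split: prod.split)
  have "(\<Sum>w\<in>\<Omega>. f w) = 1" using p(2) by (simp add: \<Omega>_def f_def sum.cartesian_product)
  then have "prob_space M" unfolding M_def
    by (intro prob_space_point_measure fin) (simp_all add: f)
  moreover have maps: "fst \<in> \<Omega> \<rightarrow> {0..N}" "snd \<in> \<Omega> \<rightarrow> {0..N}" by (auto simp: \<Omega>_def)
  then have "fst \<in> measurable M (count_space {0..N})" "snd \<in> measurable M (count_space {0..N})"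
    by (simp_all add: M_def)
  moreover have "AE w in M. real_cond_exp M (vimage_algebra (space M) snd (count_space {0..N}))
      (\<lambda>w. real (fst w)) w = c * real (snd w) + d"
    unfolding M_def
  proof (rule real_cond_exp_point_measure[OF fin f maps(2)])
    fix y assume "y \<in> {0..N}"
    then have "{w \<in> \<Omega>. snd w = y} = (\<lambda>x. (x, y)) ` {..N}" by (auto simp: \<Omega>_def)
    then show "(\<Sum>w\<in>{w \<in> \<Omega>. snd w = y}. f w * (c * real y + d - real (fst w))) = 0"
      using col[of y] by (simp add: sum.reindex inj_on_def f_def)
  qed
  moreover have "AE w in M. real_cond_exp M (vimage_algebra (space M) fst (count_space {0..N}))
      (\<lambda>w. real (snd w)) w = a * real (fst w) + b"
    unfolding M_def
  proof (rule real_cond_exp_point_measure[OF fin f maps(1)])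
    fix x assume "x \<in> {0..N}"
    then have "{w \<in> \<Omega>. fst w = x} = (\<lambda>y. (x, y)) ` {..N}" by (auto simp: \<Omega>_def)
    then show "(\<Sum>w\<in>{w \<in> \<Omega>. fst w = x}. f w * (a * real x + b - real (snd w))) = 0"
      using row[of x] by (simp add: sum.reindex inj_on_def f_def)
  qed
  ultimately show ?thesis using N by blast
qed

end
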